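(* Let $IMC$ be an infinite magic carpet graph with any fixed identification type (torus, Klein bottle, or projective plane), and let $x$ and $y$ be any two cells of $IMC$. If \[ \lim_{r\to\infty}\frac{\# B(x,r)}{r^3}=c, \] then also \[ \lim_{r\to\infty}\frac{\# B(y,r)}{r^3}=c . \]
   Context: Complex $V_m$. For $m\ge 0$ divide $Q_m=[0,3^m]^2$ into closed unit squares $[a,a+1]\times[b,b+1]$, $0\le a,b<3^m$ integers with base-3 digits $a=\sum_{j<m} a_j3^j$, $b=\sum_{j<m} b_j3^j$. The cells are the $8^m$ unit squares with $(a_j,b_j)\ne(1,1)$ for all $j<m$. The deleted region is the union of the vacant squares: a vacant square of side $s=3^j$ ($0\le j\le m-1$) is the central $3^j\times 3^j$ subsquare of a triadic block of side $3^{j+1}$, the block not being contained in a larger vacant square. For every vacant square $[p,p+s]\times[q,q+s]$ its opposite sides are identified, for $0\le t\le s$, by: torus type: $(p,q+t)\sim(p+s,q+t)$ and $(p+t,q)\sim(p+t,q+s)$; projective plane type: $(p,q+t)\sim(p+s,q+s-t)$ and $(p+t,q)\sim(p+s-t,q+s)$; Klein bottle type: one pair of opposite sides as in the torus type and the other as in the projective type, with the same choice of reversed direction at all vacant squares. The same type is used at all vacant squares. The outer boundary of $Q_m$ is not identified. The result is $V_m$; it is also regarded as a graph whose vertices are the cells, two cells being adjacent when they share a unit edge after identification. Infinite magic carpet. $V_{m+1}$ consists of eight copies of $V_m$ around a central vacant square of side $3^m$. For each $m$ choose one of the eight embeddings $V_m\subseteq V_{m+1}$; $IMC$ is the union of $V_0\subseteq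 V_1\subseteq V_2\subseteq\cdots$. The choices are assumed generic, so that there is no outer boundary (the outer squares exhaust the plane); thus $IMC$ is an infinite 4-regular graph on its cells. Distance. $d(x,y)$ is the length (number of steps) of a shortest path of successively adjacent cells from $x$ to $y$, and $B(x,r)=\{y : y \text{ is a cell of } IMC,\ d(x,y)<r\}$; $\#$ denotes cardinality. *)

theory Defs
  imports Complex_Main "HOL-Library.Extended_Real"
begin

section \<open>The complexes \<open>V\<^sub>m\<close>\<close>

text \<open>For the Klein bottle, the constructor records which pair of opposite sides is reversed;
  the choice is the same at all vacant squares.\<close>

datatype surface_type =
    Torus | Projective_Plane | Klein_Left_Right_Reversed | Klein_Bottom_Top_Reversed

definition reverses_left_right :: "surface_type \<Rightarrow> bool" where
  "reverses_left_right T \<longleftrightarrow> T = Projective_Plane \<or> T = Klein_Left_Right_Reversed"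

definition reverses_bottom_top :: "surface_type \<Rightarrow> bool" where
  "reverses_bottom_top T \<longleftrightarrow> T = Projective_Plane \<or> T = Klein_Bottom_Top_Reversed"

definition square :: "real \<Rightarrow> real \<Rightarrow> real \<Rightarrow> (real \<times> real) set" where
  "square p q s = {p..p + s} \<times> {q..q + s}"

text \<open>The cell \<open>[a, a + 1] \<times> [b, b + 1]\<close> is represented by the pair \<open>(a, b)\<close>.\<close>

definition V_cells :: "nat \<Rightarrow> (nat \<times> nat) set" where
  "V_cells m = {(a, b). a < 3 ^ m \<and> b < 3 ^ m \<and>
     (\<forall>j<m. (a div 3 ^ j mod 3, b div 3 ^ j mod 3) \<noteq> (1, 1))}"

text \<open>\<open>vacant m j p q\<close>: the square of side \<open>3 ^ j\<close> with lower left corner \<open>(p, q)\<close> is a vacant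
  square of \<open>Q\<^sub>m = [0, 3 ^ m]\<^sup>2\<close>. The recursion runs from the larger squares to the smaller ones.\<close>

function vacant :: "nat \<Rightarrow> nat \<Rightarrow> nat \<Rightarrow> nat \<Rightarrow> bool" where
  "vacant m j p q \<longleftrightarrow> j < m \<and>
     (\<exists>a b. (a + 1) * 3 ^ (j + 1) \<le> 3 ^ m \<and> (b + 1) * 3 ^ (j + 1) \<le> 3 ^ m \<and>
        p = a * 3 ^ (j + 1) + 3 ^ j \<and> q = b * 3 ^ (j + 1) + 3 ^ j \<and>
        (\<forall>k\<in>{j<..<m}. \<forall>p' q'. vacant m k p' q' \<longrightarrow>
           \<not> square (real (a * 3 ^ (j + 1))) (real (b * 3 ^ (j + 1))) (3 ^ (j + 1))
               \<subseteq> square (real p') (real q') (3 ^ k)))"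
  by pat_completeness auto
termination
  by (relation "measure (\<lambda>(m, j, p, q). m - j)") auto

declare vacant.simps [simp del]

inductive glue :: "surface_type \<Rightarrow> nat \<Rightarrow> real \<times> real \<Rightarrow> real \<times> real \<Rightarrow> bool"
  for T :: surface_type and m :: nat where
  left_right: "vacant m j p q \<Longrightarrow> s = 3 ^ j \<Longrightarrow> 0 \<le> t \<Longrightarrow> t \<le> s \<Longrightarrow>
     glue T m (real p, real q + t)
              (real p + s, real q + (if reverses_left_right T then s - t else t))"
| bottom_top: "vacant m j p q \<Longrightarrow> s = 3 ^ j \<Longrightarrow> 0 \<le> t \<Longrightarrow> t \<le> s \<Longrightarrow>
     glue T m (real p + t, real q)
              (real p + (if reverses_bottom_top T then s - t else t), real q + s)"

text \<open>The point of the quotient represented by a point of the plane.\<close>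

definition glue_class :: "surface_type \<Rightarrow> nat \<Rightarrow> real \<times> real \<Rightarrow> (real \<times> real) set" where
  "glue_class T m z = {w. equivclp (glue T m) z w}"

fun unit_edges :: "nat \<times> nat \<Rightarrow> (real \<times> real) set set" where
  "unit_edges (a, b) =
     {{real a} \<times> {real b..real b + 1}, {real a + 1} \<times> {real b..real b + 1},
      {real a..real a + 1} \<times> {real b}, {real a..real a + 1} \<times> {real b + 1}}"

definition V_adj :: "surface_type \<Rightarrow> nat \<Rightarrow> nat \<times> nat \<Rightarrow> nat \<times> nat \<Rightarrow> bool" where
  "V_adj T m x y \<longleftrightarrow> x \<in> V_cells m \<and> y \<in> V_cells m \<and> x \<noteq> y \<and>
     (\<exists>e\<in>unit_edges x. \<exists>f\<in>unit_edges y. glue_class T m ` e = glue_class T m ` f)"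


section \<open>The infinite magic carpet\<close>

text \<open>\<open>pos m\<close> tells which of the eight copies of \<open>V\<^sub>m\<close> in \<open>V\<^bsub>m+1\<^esub>\<close> is the image of \<open>V\<^sub>m\<close>.\<close>

definition embedding_choice :: "(nat \<Rightarrow> nat \<times> nat) \<Rightarrow> bool" where
  "embedding_choice pos \<longleftrightarrow> (\<forall>m. pos m \<in> {0, 1, 2} \<times> {0, 1, 2} - {(1, 1)})"

definition embed :: "(nat \<Rightarrow> nat \<times> nat) \<Rightarrow> nat \<Rightarrow> nat \<times> nat \<Rightarrow> nat \<times> nat" where
  "embed pos m z = (fst z + fst (pos m) * 3 ^ m, snd z + snd (pos m) * 3 ^ m)"

text \<open>The union of the \<open>V\<^sub>m\<close> is realised in the plane, with \<open>V\<^sub>0\<close> at \<open>[0, 1]\<^sup>2\<close>: \<open>place pos m\<close> is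
  the resulting position of a cell of \<open>V\<^sub>m\<close>, and \<open>outer_square pos m\<close> that of \<open>Q\<^sub>m\<close>.\<close>

definition place :: "(nat \<Rightarrow> nat \<times> nat) \<Rightarrow> nat \<Rightarrow> nat \<times> nat \<Rightarrow> int \<times> int" where
  "place pos m z = (int (fst z) - (\<Sum>j<m. int (fst (pos j)) * 3 ^ j),
                    int (snd z) - (\<Sum>j<m. int (snd (pos j)) * 3 ^ j))"

definition outer_square :: "(nat \<Rightarrow> nat \<times> nat) \<Rightarrow> nat \<Rightarrow> (real \<times> real) set" where
  "outer_square pos m = square (- (\<Sum>j<m. real (fst (pos j)) * 3 ^ j))
                               (- (\<Sum>j<m. real (snd (pos j)) * 3 ^ j)) (3 ^ m)"

lemma place_0: "place pos 0 (0, 0) = (0, 0)"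
  by (simp add: place_def)

lemma place_embed: "place pos (Suc m) (embed pos m z) = place pos m z"
  by (simp add: place_def embed_def)

definition no_outer_boundary :: "(nat \<Rightarrow> nat \<times> nat) \<Rightarrow> bool" where
  "no_outer_boundary pos \<longleftrightarrow> (\<Union>m. outer_square pos m) = UNIV"

definition IMC_cells :: "(nat \<Rightarrow> nat \<times> nat) \<Rightarrow> (int \<times> int) set" where
  "IMC_cells pos = (\<Union>m. place pos m ` V_cells m)"

definition IMC_adj ::
  "surface_type \<Rightarrow> (nat \<Rightarrow> nat \<times> nat) \<Rightarrow> int \<times> int \<Rightarrow> int \<times> int \<Rightarrow> bool" where
  "IMC_adj T pos x y \<longleftrightarrow>
     (\<exists>m x' y'. x = place pos m x' \<and> y = place pos m y' \<and> V_adj T m x' y')"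

definition IMC_dist ::
  "surface_type \<Rightarrow> (nat \<Rightarrow> nat \<times> nat) \<Rightarrow> int \<times> int \<Rightarrow> int \<times> int \<Rightarrow> enat" where
  "IMC_dist T pos x y = (INF n\<in>{n. (IMC_adj T pos ^^ n) x y}. enat n)"

definition IMC_ball ::
  "surface_type \<Rightarrow> (nat \<Rightarrow> nat \<times> nat) \<Rightarrow> int \<times> int \<Rightarrow> real \<Rightarrow> (int \<times> int) set" where
  "IMC_ball T pos x r = {y \<in> IMC_cells pos. ereal_of_enat (IMC_dist T pos x y) < ereal r}"

end

theory Submission
  imports Defs
begin

text \<open>The carpet graph is connected, so \<open>x\<close> and \<open>y\<close> lie at a finite distance \<open>D\<close>, and concatenating
  paths gives \<open>B(x, r - D) \<subseteq> B(y, r) \<subseteq> B(x, r + D)\<close> for all \<open>r\<close>. Since \<open>(r \<plusminus> D)\<^sup>3 / r\<^sup>3\<close> tends to \<open>1\<close>,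
  the two growth functions divided by \<open>r\<^sup>3\<close> have the same limit
  (\<open>card_div_power_tendsto_interleaved\<close>).

  Connectedness (\<open>V_cells_grid_connected\<close>) already holds for the carpet drawn in the plane: cells
  that share an edge before any identification are adjacent after it. It follows by induction on
  the level, because the eight copies of \<open>V\<^sub>m\<close> in \<open>V\<^bsub>m+1\<^esub>\<close> form a ring in which consecutive copies
  meet along full sides of \<open>Q\<^sub>m\<close>, and no cell along the boundary of \<open>Q\<^sub>m\<close> is missing.\<close>


section \<open>Growth rates of interleaved families of sets\<close>

lemma tendsto_shifted_div_power:
  fixes g :: "real \<Rightarrow> real"
  assumes "((\<lambda>r. g r / r ^ n) \<longlongrightarrow> c) at_top"
  shows "((\<lambda>r. g (r + d) / r ^ n) \<longlongrightarrow> c) at_top"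
proof -
  have shift: "filterlim (\<lambda>r::real. r + d) at_top at_top"
    unfolding add.commute[of _ d]
    by (intro filterlim_tendsto_add_at_top[OF tendsto_const] filterlim_ident)
  have "((\<lambda>r. 1 + d / r) \<longlongrightarrow> 1 + 0) at_top"
    by (intro tendsto_add tendsto_const tendsto_divide_0[OF tendsto_const]
        filterlim_at_top_imp_at_infinity filterlim_ident)
  then have "((\<lambda>r. g (r + d) / (r + d) ^ n * (1 + d / r) ^ n) \<longlongrightarrow> c * (1 + 0) ^ n) at_top"
    by (intro tendsto_mult tendsto_power filterlim_compose[OF assms shift])
  moreover have "\<forall>\<^sub>F r in at_top. g (r + d) / (r + d) ^ n * (1 + d / r) ^ n = g (r + d) / r ^ n"
    using eventually_gt_at_top[of "max 0 (- d)"]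
  proof eventually_elim
    case (elim r)
    then have "1 + d / r = (r + d) / r" "r + d \<noteq> 0"
      by (auto simp: field_simps)
    then show ?case
      by (simp add: power_divide)
  qed
  ultimately show ?thesis
    using Lim_transform_eventually by fastforce
qed

text \<open>Since \<open>card\<close> is \<open>0\<close> on infinite sets, monotonicity of the cardinality is available only for
  finite families. If one of the sets is infinite, then interleaving makes both families infinite
  from some radius on, and both quotients are eventually \<open>0\<close>.\<close>

lemma card_div_power_tendsto_interleaved:
  fixes A B :: "real \<Rightarrow> 'a set"
  assumes mono: "\<And>r s. r \<le> s \<Longrightarrow> A r \<subseteq> A s"
    and AB: "\<And>r. A r \<subseteq> B (r + d)" and BA: "\<And>r. B r \<subseteq> A (r + e)"
    and lim: "((\<lambda>r. real (card (A r)) / r ^ n) \<longlongrightarrow> c) at_top"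
  shows "((\<lambda>r. real (card (B r)) / r ^ n) \<longlongrightarrow> c) at_top"
proof (cases "\<forall>r. finite (A r)")
  case True
  have "finite (B r)" for r
    using True BA finite_subset by blast
  then have lower: "card (A (r + - d)) \<le> card (B r)" for r
    using AB[of "r + - d"] by (simp add: card_mono)
  have upper: "card (B r) \<le> card (A (r + e))" for r
    using True BA by (simp add: card_mono)
  show ?thesis
  proof (rule tendsto_sandwich)
    show "\<forall>\<^sub>F r in at_top. real (card (A (r + - d))) / r ^ n \<le> real (card (B r)) / r ^ n"
      using eventually_ge_at_top[of 0]
      by eventually_elim (simp only: divide_right_mono of_nat_mono[OF lower] zero_le_power)
    show "\<forall>\<^sub>F r in at_top. real (card (B r)) / r ^ n \<le> real (card (A (r + e))) / r ^ n"
      using eventually_ge_at_top[of 0]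
      by eventually_elim (simp only: divide_right_mono of_nat_mono[OF upper] zero_le_power)
  qed (rule tendsto_shifted_div_power[OF lim])+
next
  case False
  then obtain r0 where r0: "infinite (A r0)"
    by blast
  have "infinite (A r)" if "r \<ge> r0" for r
    using r0 mono[OF that] finite_subset by blast
  then have "\<forall>\<^sub>F r in at_top. real (card (A r)) / r ^ n = 0"
    by (intro eventually_at_top_linorderI[of r0]) simp
  then have "((\<lambda>r. real (card (A r)) / r ^ n) \<longlongrightarrow> 0) at_top"
    by (rule tendsto_eventually)
  then have c: "c = 0"
    using lim by (meson tendsto_unique trivial_limit_at_top_linorder)
  have "infinite (B r)" if "r \<ge> r0 + d" for r
  proof -
    have "A r0 \<subseteq> B r"
      using AB[of "r - d"] mono[of r0 "r - d"] that by auto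
    then show ?thesis
      using r0 finite_subset by blast
  qed
  then have "\<forall>\<^sub>F r in at_top. real (card (B r)) / r ^ n = 0"
    by (intro eventually_at_top_linorderI[of "r0 + d"]) simp
  then show ?thesis
    unfolding c by (rule tendsto_eventually)
qed


section \<open>Connectedness of the planar carpet\<close>

definition grid_adj :: "nat \<Rightarrow> nat \<times> nat \<Rightarrow> nat \<times> nat \<Rightarrow> bool" where
  "grid_adj m u v \<longleftrightarrow> u \<in> V_cells m \<and> v \<in> V_cells m \<and>
     (v = (Suc (fst u), snd u) \<or> v = (fst u, Suc (snd u)) \<or>
      u = (Suc (fst v), snd v) \<or> u = (fst v, Suc (snd v)))"

lemma grid_reach_sym: "(grid_adj m)\<^sup>*\<^sup>* u v \<Longrightarrow> (grid_adj m)\<^sup>*\<^sup>* v u"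
  by (rule sympD[OF symp_rtranclp[OF sympI]]) (unfold grid_adj_def, blast)

text \<open>A common edge in the plane has the same image in the quotient, whatever the identification
  type.\<close>

lemma grid_adj_imp_V_adj:
  assumes "grid_adj m u v"
  shows "V_adj T m u v"
proof -
  have Suc: "real (Suc a) = real a + 1" for a
    by simp
  have "{real (Suc a)} \<times> {real b..real b + 1} \<in> unit_edges (a, b) \<inter> unit_edges (Suc a, b)"
    "{real a..real a + 1} \<times> {real (Suc b)} \<in> unit_edges (a, b) \<inter> unit_edges (a, Suc b)" for a b
    by (simp_all only: unit_edges.simps Suc Int_iff insert_iff simp_thms)
  moreover obtain a b where "u = (a, b) \<and> v \<in> {(Suc a, b), (a, Suc b)} \<or>
      v = (a, b) \<and> u \<in> {(Suc a, b), (a, Suc b)}"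
    using assms unfolding grid_adj_def by (metis insert_iff prod.collapse)
  ultimately have "\<exists>e. e \<in> unit_edges u \<and> e \<in> unit_edges v"
    by blast
  moreover have "u \<noteq> v"
    using assms unfolding grid_adj_def by (metis fst_conv n_not_Suc_n snd_conv)
  ultimately show ?thesis
    using assms unfolding V_adj_def grid_adj_def by blast
qed

abbreviation block_positions :: "(nat \<times> nat) set" where
  "block_positions \<equiv> {0, 1, 2} \<times> {0, 1, 2} - {(1, 1)}"

lemma digit_shift:
  fixes a :: nat
  assumes "a < 3 ^ m" "i < 3" "j \<le> m"
  shows "(a + i * 3 ^ m) div 3 ^ j mod 3 = (if j = m then i else a div 3 ^ j mod 3)"
proof (cases "j = m")
  case False
  define l where "l = m - Suc j"
  have m: "m = j + Suc l"
    using assms False by (simp add: l_def)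
  have "a + i * 3 ^ m = a + (i * 3 ^ l * 3) * 3 ^ j"
    by (simp add: m power_add)
  then have "(a + i * 3 ^ m) div 3 ^ j = i * 3 ^ l * 3 + a div 3 ^ j"
    by (simp only: div_mult_self1 power_not_zero zero_neq_numeral[symmetric] not_False_eq_True)
  then show ?thesis
    using False by simp
qed (use assms in auto)

lemma shift_mem_V_cells_Suc_iff:
  assumes "a < 3 ^ m" "b < 3 ^ m" "i < 3" "k < 3"
  shows "(a + i * 3 ^ m, b + k * 3 ^ m) \<in> V_cells (Suc m) \<longleftrightarrow>
    (a, b) \<in> V_cells m \<and> (i, k) \<noteq> (1, 1)"
proof -
  have "i * 3 ^ m \<le> 2 * 3 ^ m" "k * 3 ^ m \<le> 2 * (3 ^ m :: nat)"
    using assms by (simp_all only: mult_le_mono1 less_Suc_eq_le numeral_3_eq_3 numeral_2_eq_2)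
  then have "a + i * 3 ^ m < 3 ^ Suc m" "b + k * 3 ^ m < 3 ^ Suc m"
    using assms(1,2) by (simp_all only: power_Suc)
  then show ?thesis
    using assms by (auto simp: V_cells_def less_Suc_eq_le digit_shift le_less)
qed

lemma embedded_mem_V_cells_Suc:
  assumes "u \<in> V_cells m" "ik \<in> block_positions"
  shows "(fst u + fst ik * 3 ^ m, snd u + snd ik * 3 ^ m) \<in> V_cells (Suc m)"
proof -
  have "fst u < 3 ^ m" "snd u < 3 ^ m"
    using assms(1) by (auto simp: V_cells_def)
  moreover have "fst ik < 3" "snd ik < 3" "(fst ik, snd ik) \<noteq> (1, 1)"
    using assms(2) by auto
  ultimately show ?thesis
    using assms(1) shift_mem_V_cells_Suc_iff[of "fst u" m "snd u" "fst ik" "snd ik"] by simp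
qed

lemma V_cells_Suc_cases:
  assumes "u \<in> V_cells (Suc m)"
  obtains a b i k where "u = (a + i * 3 ^ m, b + k * 3 ^ m)" "(a, b) \<in> V_cells m"
    "(i, k) \<in> block_positions"
proof -
  obtain p q where u: "u = (p, q)"
    by (cases u)
  have quotients: "p div 3 ^ m < 3" "q div 3 ^ m < 3"
    using assms by (auto simp: u V_cells_def less_mult_imp_div_less)
  moreover have u_split: "u = (p mod 3 ^ m + p div 3 ^ m * 3 ^ m, q mod 3 ^ m + q div 3 ^ m * 3 ^ m)"
    by (simp only: u mod_div_mult_eq)
  ultimately have "(p mod 3 ^ m, q mod 3 ^ m) \<in> V_cells m"
    "(p div 3 ^ m, q div 3 ^ m) \<noteq> (1, 1)"
    using assms
      shift_mem_V_cells_Suc_iff[of "p mod 3 ^ m" m "q mod 3 ^ m" "p div 3 ^ m" "q div 3 ^ m"]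
    by simp_all
  moreover have "n \<in> {0, 1, 2}" if "n < 3" for n :: nat
    using that by auto
  ultimately show thesis
    using that u_split quotients by blast
qed

text \<open>The second and third parts run inside one copy of \<open>V\<^sub>m\<close> to a corner cell next to the following
  copy and then step across the common side. The step is possible because the corner cells \<open>(0, 0)\<close>,
  \<open>(3 ^ m - 1, 0)\<close> and \<open>(0, 3 ^ m - 1)\<close> of \<open>V\<^sub>m\<close> are never deleted.\<close>

lemma block_corners_reach:
  assumes conn: "\<And>v. v \<in> V_cells m \<Longrightarrow> (grid_adj m)\<^sup>*\<^sup>* (0, 0) v"
    and ik: "(i, k) \<in> block_positions"
  shows "(a, b) \<in> V_cells m \<Longrightarrow>
      (grid_adj (Suc m))\<^sup>*\<^sup>* (i * 3 ^ m, k * 3 ^ m) (a + i * 3 ^ m, b + k * 3 ^ m)"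
    and "(Suc i, k) \<in> block_positions \<Longrightarrow>
      (grid_adj (Suc m))\<^sup>*\<^sup>* (i * 3 ^ m, k * 3 ^ m) (Suc i * 3 ^ m, k * 3 ^ m)"
    and "(i, Suc k) \<in> block_positions \<Longrightarrow>
      (grid_adj (Suc m))\<^sup>*\<^sup>* (i * 3 ^ m, k * 3 ^ m) (i * 3 ^ m, Suc k * 3 ^ m)"
proof -
  let ?sh = "\<lambda>v::nat \<times> nat. (fst v + i * 3 ^ m, snd v + k * 3 ^ m)"
  have step: "grid_adj (Suc m) (?sh u) (?sh v)" if "grid_adj m u v" for u v
    using that embedded_mem_V_cells_Suc[OF _ ik, of u m] embedded_mem_V_cells_Suc[OF _ ik, of v m]
    by (auto simp: grid_adj_def)
  have lift: "(grid_adj (Suc m))\<^sup>*\<^sup>* (?sh (0, 0)) (?sh v)" if "v \<in> V_cells m" for v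
    using conn[OF that] by induction (auto intro: rtranclp.rtrancl_into_rtrancl step)
  show "(grid_adj (Suc m))\<^sup>*\<^sup>* (i * 3 ^ m, k * 3 ^ m) (a + i * 3 ^ m, b + k * 3 ^ m)"
    if "(a, b) \<in> V_cells m"
    using lift[OF that] by simp
  have corners: "(0, 0) \<in> V_cells m" "(3 ^ m - 1, 0) \<in> V_cells m" "(0, 3 ^ m - 1) \<in> V_cells m"
    by (auto simp: V_cells_def)
  have pos: "(0::nat) < 3 ^ m"
    by simp
  show "(grid_adj (Suc m))\<^sup>*\<^sup>* (i * 3 ^ m, k * 3 ^ m) (Suc i * 3 ^ m, k * 3 ^ m)"
    if next_pos: "(Suc i, k) \<in> block_positions"
  proof -
    have "grid_adj (Suc m) (?sh (3 ^ m - 1, 0)) (Suc i * 3 ^ m, k * 3 ^ m)"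
      using embedded_mem_V_cells_Suc[OF corners(2) ik] pos
        embedded_mem_V_cells_Suc[OF corners(1) next_pos]
      by (auto simp: grid_adj_def)
    then show ?thesis
      using lift[OF corners(2)] by (simp add: rtranclp.rtrancl_into_rtrancl)
  qed
  show "(grid_adj (Suc m))\<^sup>*\<^sup>* (i * 3 ^ m, k * 3 ^ m) (i * 3 ^ m, Suc k * 3 ^ m)"
    if next_pos: "(i, Suc k) \<in> block_positions"
  proof -
    have "grid_adj (Suc m) (?sh (0, 3 ^ m - 1)) (i * 3 ^ m, Suc k * 3 ^ m)"
      using embedded_mem_V_cells_Suc[OF corners(3) ik] pos
        embedded_mem_V_cells_Suc[OF corners(1) next_pos]
      by (auto simp: grid_adj_def)
    then show ?thesis
      using lift[OF corners(3)] by (simp add: rtranclp.rtrancl_into_rtrancl)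
  qed
qed

lemma grid_reach_from_origin: "v \<in> V_cells m \<Longrightarrow> (grid_adj m)\<^sup>*\<^sup>* (0, 0) v"
proof (induction m arbitrary: v)
  case 0
  then show ?case
    by (auto simp: V_cells_def)
next
  case (Suc m)
  let ?R = "\<lambda>i k. (grid_adj (Suc m))\<^sup>*\<^sup>* (0, 0) (i * 3 ^ m, k * 3 ^ m)"
  have right: "?R (Suc i) k"
    if "?R i k" "(i, k) \<in> block_positions" "(Suc i, k) \<in> block_positions" for i k
    using rtranclp_trans[OF that(1) block_corners_reach(2)[OF Suc.IH that(2,3)]] .
  have up: "?R i (Suc k)"
    if "?R i k" "(i, k) \<in> block_positions" "(i, Suc k) \<in> block_positions" for i k
    using rtranclp_trans[OF that(1) block_corners_reach(3)[OF Suc.IH that(2,3)]] .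
  \<comment> \<open>Two arcs from the lower left corner block to the upper right one cover the ring.\<close>
  have "?R 0 0"
    by simp
  moreover from this have "?R 1 0"
    using right[of 0 0] by simp
  moreover from this have "?R 2 0"
    using right[of 1 0] by (simp add: numeral_2_eq_2)
  moreover from this have "?R 2 1"
    using up[of 2 0] by simp
  moreover from this have "?R 2 2"
    using up[of 2 1] by (simp add: numeral_2_eq_2)
  moreover have "?R 0 1"
    using up[of 0 0] by simp
  moreover from this have "?R 0 2"
    using up[of 0 1] by (simp add: numeral_2_eq_2)
  moreover from this have "?R 1 2"
    using right[of 0 2] by simp
  ultimately have ring: "?R i k" if "(i, k) \<in> block_positions" for i k
    using that by auto
  from Suc.prems obtain a b i k where v: "v = (a + i * 3 ^ m, b + k * 3 ^ m)"
    "(a, b) \<in> V_cells m" "(i, k) \<in> block_positions"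
    by (rule V_cells_Suc_cases)
  show ?case
    unfolding v(1)
    using rtranclp_trans[OF ring[OF v(3)] block_corners_reach(1)[OF Suc.IH v(3,2)]] .
qed

lemma V_cells_grid_connected:
  "u \<in> V_cells m \<Longrightarrow> v \<in> V_cells m \<Longrightarrow> (grid_adj m)\<^sup>*\<^sup>* u v"
  using rtranclp_trans[OF grid_reach_sym[OF grid_reach_from_origin] grid_reach_from_origin] .


section \<open>The infinite magic carpet\<close>

lemma place_V_cells_mono:
  assumes "embedding_choice pos" "m \<le> n"
  shows "place pos m ` V_cells m \<subseteq> place pos n ` V_cells n"
  using \<open>m \<le> n\<close>
proof (rule lift_Suc_mono_le[of "\<lambda>m. place pos m ` V_cells m", rotated])
  fix m
  have "embed pos m u \<in> V_cells (Suc m)" if "u \<in> V_cells m" for u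
    using embedded_mem_V_cells_Suc[OF that] assms(1)
    unfolding embed_def embedding_choice_def by blast
  then show "place pos m ` V_cells m \<subseteq> place pos (Suc m) ` V_cells (Suc m)"
    by (metis image_subsetI image_eqI place_embed)
qed

text \<open>The two cells lie in a common finite stage, and already there they are joined by a path.\<close>

lemma IMC_connected:
  assumes "embedding_choice pos" "x \<in> IMC_cells pos" "y \<in> IMC_cells pos"
  shows "\<exists>n. (IMC_adj T pos ^^ n) x y"
proof -
  obtain k l where "x \<in> place pos k ` V_cells k" "y \<in> place pos l ` V_cells l"
    using assms by (auto simp: IMC_cells_def)
  then have "x \<in> place pos (max k l) ` V_cells (max k l)"
    "y \<in> place pos (max k l) ` V_cells (max k l)"
    using place_V_cells_mono[OF assms(1)] by (meson max.cobounded1 max.cobounded2 subsetD)+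
  then obtain m u v where uv: "x = place pos m u" "y = place pos m v"
    "u \<in> V_cells m" "v \<in> V_cells m"
    by blast
  have step: "IMC_adj T pos (place pos m v) (place pos m w)" if "grid_adj m v w" for v w
    using grid_adj_imp_V_adj[OF that] unfolding IMC_adj_def by blast
  have "(IMC_adj T pos)\<^sup>*\<^sup>* (place pos m u) (place pos m v)"
    using V_cells_grid_connected[OF uv(3,4)]
    by induction (auto intro: rtranclp.rtrancl_into_rtrancl step)
  then show ?thesis
    by (simp add: uv rtranclp_power)
qed

text \<open>The infimum defining the distance is attained if there is a path at all, since \<open>nat\<close> is
  well-ordered; otherwise it is \<open>\<infinity>\<close> and the cell lies in no ball.\<close>

lemma mem_IMC_ball_iff:
  "z \<in> IMC_ball T pos x r \<longleftrightarrow>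
    z \<in> IMC_cells pos \<and> (\<exists>n. (IMC_adj T pos ^^ n) x z \<and> real n < r)"
proof (cases "\<exists>n. (IMC_adj T pos ^^ n) x z")
  case True
  define k where "k = (LEAST n. (IMC_adj T pos ^^ n) x z)"
  have path: "(IMC_adj T pos ^^ k) x z"
    unfolding k_def using True by (rule LeastI_ex)
  have least: "k \<le> n" if "(IMC_adj T pos ^^ n) x z" for n
    unfolding k_def using that by (rule Least_le)
  have "IMC_dist T pos x z = enat k"
    unfolding IMC_dist_def using path least
    by (intro antisym INF_lower INF_greatest) auto
  then show ?thesis
    using path least by (auto simp: IMC_ball_def dest: order_le_less_trans[OF of_nat_mono])
next
  case False
  then have "IMC_dist T pos x z = \<infinity>"
    by (simp add: IMC_dist_def top_enat_def)
  then show ?thesis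
    using False by (simp add: IMC_ball_def)
qed

lemma IMC_ball_shift:
  assumes "(IMC_adj T pos ^^ d) y x"
  shows "IMC_ball T pos x r \<subseteq> IMC_ball T pos y (r + real d)"
proof
  fix z
  assume "z \<in> IMC_ball T pos x r"
  then obtain n where n: "z \<in> IMC_cells pos" "(IMC_adj T pos ^^ n) x z" "real n < r"
    by (auto simp: mem_IMC_ball_iff)
  then have "(IMC_adj T pos ^^ (d + n)) y z"
    using assms by (auto simp: relpowp_add)
  moreover have "real (d + n) < r + real d"
    using n by simp
  ultimately show "z \<in> IMC_ball T pos y (r + real d)"
    using n mem_IMC_ball_iff by blast
qed

theorem proposition2p22:
  fixes T :: surface_type and pos :: "nat \<Rightarrow> nat \<times> nat"
    and x y :: "int \<times> int" and c :: real
  assumes "embedding_choice pos"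
    and "no_outer_boundary pos"
    and "x \<in> IMC_cells pos"
    and "y \<in> IMC_cells pos"
    and "((\<lambda>r::real. real (card (IMC_ball T pos x r)) / r ^ 3) \<longlongrightarrow> c) at_top"
  shows "((\<lambda>r::real. real (card (IMC_ball T pos y r)) / r ^ 3) \<longlongrightarrow> c) at_top"
proof -
  obtain d where d: "(IMC_adj T pos ^^ d) y x"
    using IMC_connected assms by blast
  obtain e where e: "(IMC_adj T pos ^^ e) x y"
    using IMC_connected assms by blast
  have "IMC_ball T pos x r \<subseteq> IMC_ball T pos x s" if "r \<le> s" for r s
    using that order_less_le_trans by (fastforce simp: mem_IMC_ball_iff)
  then show ?thesis
    using IMC_ball_shift[OF d] IMC_ball_shift[OF e] assms(5)
    by (rule card_div_power_tendsto_interleaved)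
qed

end
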